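(* Let $\alpha\leq-1$ and let $u$ be an $\alpha$-harmonic function in $\mathbb{D}$. Assume that the limit $f=\lim_{r\to1}u_r$ in $\mathcal{D}'(\mathbb{T})$ exists, where $u_r(e^{i\theta})=u(re^{i\theta})$ for $e^{i\theta}\in\mathbb{T}$ and $0\leq r<1$. Then $u$ is analytic in $\mathbb{D}$.
   Context: $\mathbb{D}$ is the open unit disc in $\mathbb{C}$, $\mathbb{T}=\partial\mathbb{D}$. Functions are complex-valued; $\partial_z=\frac12(\partial_x-i\partial_y)$, $\bar\partial_z=\frac12(\partial_x+i\partial_y)$. For $\alpha\in\mathbb{R}$, $u\in C^2(\mathbb{D})$ is $\alpha$-harmonic in $\mathbb{D}$ if $\partial_z\big((1-|z|^2)^{-\alpha}\bar\partial_z u(z)\big)=0$ in $\mathbb{D}$. $\mathcal{D}'(\mathbb{T})$ is the space of distributions on $\mathbb{T}$, with $f\in L^1(\mathbb{T})$ identified with $\langle f,\psi\rangle=\frac1{2\pi}\int_{\mathbb{T}}f(e^{i\theta})\psi(e^{i\theta})\,d\theta$, $\psi\in C^\infty(\mathbb{T})$. Convergence $u_r\to f$ in $\mathcal{D}'(\mathbb{T})$ means $\langle u_r,\psi\rangle\to\langle f,\psi\rangle$ for every $\psi\in C^\infty(\mathbb{T})$. Here $r\to1$ is taken with $r<1$. *)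

theory Defs
  imports "HOL-Analysis.Analysis"
begin

section \<open>Real partial derivatives and Wirtinger operators\<close>

definition partial_x :: "(complex \<Rightarrow> complex) \<Rightarrow> complex \<Rightarrow> complex" where
  "partial_x u z = frechet_derivative u (at z) 1"

definition partial_y :: "(complex \<Rightarrow> complex) \<Rightarrow> complex \<Rightarrow> complex" where
  "partial_y u z = frechet_derivative u (at z) \<i>"

definition wirtinger :: "(complex \<Rightarrow> complex) \<Rightarrow> complex \<Rightarrow> complex" where
  "wirtinger u z = (partial_x u z - \<i> * partial_y u z) / 2"

definition wirtinger_bar :: "(complex \<Rightarrow> complex) \<Rightarrow> complex \<Rightarrow> complex" where
  "wirtinger_bar u z = (partial_x u z + \<i> * partial_y u z) / 2"

text \<open>Real differentiability class \<open>C\<^sup>k\<close>; used on open sets only. Here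
  \<open>differentiable_on\<close> is differentiability over the reals.\<close>

fun Ck_on :: "nat \<Rightarrow> (complex \<Rightarrow> complex) \<Rightarrow> complex set \<Rightarrow> bool" where
  "Ck_on 0 u S \<longleftrightarrow> continuous_on S u"
| "Ck_on (Suc k) u S \<longleftrightarrow>
     u differentiable_on S \<and> Ck_on k (partial_x u) S \<and> Ck_on k (partial_y u) S"

definition alpha_harmonic :: "real \<Rightarrow> (complex \<Rightarrow> complex) \<Rightarrow> bool" where
  "alpha_harmonic \<alpha> u \<longleftrightarrow>
     Ck_on 2 u (ball 0 1) \<and>
     (\<forall>z\<in>ball 0 1.
        wirtinger (\<lambda>w. of_real ((1 - (cmod w)\<^sup>2) powr (- \<alpha>)) * wirtinger_bar u w) z = 0)"

section \<open>Distributions on the unit circle\<close>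

text \<open>A function on the circle is a function on the complex plane of which only the values on
  \<open>sphere 0 1\<close> matter. Its derivatives are taken with respect to the angle.\<close>

definition angular_deriv :: "nat \<Rightarrow> (complex \<Rightarrow> complex) \<Rightarrow> real \<Rightarrow> complex" where
  "angular_deriv k \<psi> = ((\<lambda>g t. vector_derivative g (at t)) ^^ k) (\<lambda>t. \<psi> (cis t))"

definition smooth_circle :: "(complex \<Rightarrow> complex) set" where
  "smooth_circle = {\<psi>. \<forall>k t. angular_deriv k \<psi> differentiable (at t)}"

text \<open>Distributions are the continuous linear functionals on the smooth functions. Continuity is
  expressed by the seminorms of the usual Frechet topology; together with linearity it makes the
  value of the functional depend only on the restriction of the test function to the circle.\<close>

definition circle_distribution :: "((complex \<Rightarrow> complex) \<Rightarrow> complex) \<Rightarrow> bool" where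
  "circle_distribution F \<longleftrightarrow>
     (\<forall>\<psi>\<in>smooth_circle. \<forall>\<phi>\<in>smooth_circle. F (\<lambda>z. \<psi> z + \<phi> z) = F \<psi> + F \<phi>) \<and>
     (\<forall>\<psi>\<in>smooth_circle. \<forall>c. F (\<lambda>z. c * \<psi> z) = c * F \<psi>) \<and>
     (\<exists>C N. \<forall>\<psi>\<in>smooth_circle.
        cmod (F \<psi>) \<le> C * (\<Sum>k\<le>N. SUP t. cmod (angular_deriv k \<psi> t)))"

definition distribution_of :: "(complex \<Rightarrow> complex) \<Rightarrow> (complex \<Rightarrow> complex) \<Rightarrow> complex" where
  "distribution_of f \<psi> = (LBINT \<theta>:{0..2 * pi}. f (cis \<theta>) * \<psi> (cis \<theta>)) / (2 * pi)"

definition tendsto_circle_distribution ::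
  "('a \<Rightarrow> (complex \<Rightarrow> complex) \<Rightarrow> complex) \<Rightarrow> ((complex \<Rightarrow> complex) \<Rightarrow> complex) \<Rightarrow> 'a filter \<Rightarrow> bool"
  where
  "tendsto_circle_distribution G F flt \<longleftrightarrow>
     (\<forall>\<psi>\<in>smooth_circle. ((\<lambda>r. G r \<psi>) \<longlongrightarrow> F \<psi>) flt)"

definition dilation :: "(complex \<Rightarrow> complex) \<Rightarrow> real \<Rightarrow> complex \<Rightarrow> complex" where
  "dilation u r = (\<lambda>\<zeta>. u (of_real r * \<zeta>))"

end

theory Submission
  imports Defs "HOL-Complex_Analysis.Cauchy_Integral_Formula" "HOL-Real_Asymp.Real_Asymp"
begin

text \<open>
  By hypothesis \<open>wirtinger_bar u z = (1 - |z|\<^sup>2)\<^sup>\<alpha> cnj (G z)\<close> with \<open>G\<close> holomorphic in the disc.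
  The moment \<open>A r\<close> of \<open>u z * z ^ (k + 1)\<close> over the circle \<open>|z| = r\<close> has the derivative
  \<open>4 \<pi> cnj c\<^sub>k (1 - r\<^sup>2)\<^sup>\<alpha> r\<^bsup>2k + 1\<^esup>\<close>, where \<open>c\<^sub>k\<close> is the \<open>k\<close>-th Taylor coefficient
  of \<open>G\<close>. For \<open>\<alpha> \<le> -1\<close> this is not integrable at \<open>r = 1\<close> unless \<open>c\<^sub>k = 0\<close>, whereas the limit
  in the sense of distributions, tested against \<open>z ^ (k + 1)\<close>, makes \<open>A\<close> converge. So \<open>G = 0\<close>
  and \<open>u\<close> satisfies the Cauchy-Riemann equations.
\<close>

text \<open>A real-linear map of the plane splits into a complex-linear and a conjugate-linear part.
  Complex differentiability is thus the vanishing of the second coefficient, and that of the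
  conjugate function the vanishing of the first.\<close>

lemma has_derivative_wirtinger:
  assumes "u differentiable (at z)"
  shows "(u has_derivative (\<lambda>w. wirtinger u z * w + wirtinger_bar u z * cnj w)) (at z)"
proof -
  define D where "D = frechet_derivative u (at z)"
  have D: "(u has_derivative D) (at z)"
    using assms by (simp add: D_def frechet_derivative_works)
  then interpret linear D
    by (rule has_derivative_linear)
  have "D w = wirtinger u z * w + wirtinger_bar u z * cnj w" for w
  proof -
    have "D w = D (Re w *\<^sub>R 1 + Im w *\<^sub>R \<i>)"
      by (rule arg_cong[where f = D]) (simp add: complex_eq_iff)
    also have "\<dots> = Re w *\<^sub>R D 1 + Im w *\<^sub>R D \<i>"
      by (simp only: add scale)
    also have "\<dots> = wirtinger u z * w + wirtinger_bar u z * cnj w"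
      by (simp add: wirtinger_def wirtinger_bar_def partial_x_def partial_y_def
            D_def[symmetric] complex_eq_iff field_simps)
    finally show ?thesis .
  qed
  then have "D = (\<lambda>w. wirtinger u z * w + wirtinger_bar u z * cnj w)"
    by blast
  with D show ?thesis by simp
qed

text \<open>On the circle a monomial is the character \<open>cis (n * t)\<close>, an eigenfunction
  of d/dt with eigenvalue \<open>\<i> * n\<close>. Monomials are the test functions that extract the
  moments of \<open>u\<close>.\<close>

lemma power_in_smooth_circle: "(\<lambda>z. z ^ n) \<in> smooth_circle"
proof -
  have deriv: "((\<lambda>t. c * cis (real n * t)) has_vector_derivative \<i> * n * c * cis (real n * t)) (at t)"
    for c t
    by (auto intro!: derivative_eq_intros simp: has_vector_derivative_def scaleR_conv_of_real)
  have "angular_deriv k (\<lambda>z. z ^ n) = (\<lambda>t. (\<i> * n) ^ k * cis (real n * t))" for k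
  proof (induction k)
    case 0
    show ?case by (simp add: angular_deriv_def Complex.DeMoivre)
  next
    case (Suc k)
    then show ?case
      using vector_derivative_at[OF deriv] by (simp add: angular_deriv_def)
  qed
  then show ?thesis
    by (simp only: smooth_circle_def mem_Collect_eq differentiableI_vector[OF deriv] simp_thms)
qed

text \<open>The factor \<open>z ^ Suc k\<close> is holomorphic, so the bar derivative falls on
  \<open>u\<close> alone. Differentiating under the integral gives the radial derivative, which
  differs from a bar derivative only by an exact angular term. The right-hand side arises from
  \<open>cnj z * z ^ Suc k = r\<^sup>2 * z ^ k\<close> after division by \<open>r\<close>.\<close>

lemma has_vector_derivative_circle_moment:
  fixes u :: "complex \<Rightarrow> complex"
  assumes diff: "u differentiable_on ball 0 1"
    and cont: "continuous_on (ball 0 1) (wirtinger u)" "continuous_on (ball 0 1) (wirtinger_bar u)"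
    and r: "0 < r" "r < 1"
  shows "((\<lambda>r. integral {0..2*pi} (\<lambda>t. u (of_real r * cis t) * (of_real r * cis t) ^ Suc k))
      has_vector_derivative
      2 * of_real r * integral {0..2*pi} (\<lambda>t. wirtinger_bar u (of_real r * cis t) * (of_real r * cis t) ^ k))
      (at r)"
proof -
  define f where "f z = u z * z ^ Suc k" for z
  \<comment> \<open>\<open>p\<close> and \<open>q\<close> are the two Wirtinger derivatives of
    \<open>f\<close>, by the product rule.\<close>
  define p where "p z = wirtinger u z * z ^ Suc k + u z * (of_nat (Suc k) * z ^ k)" for z
  define q where "q z = wirtinger_bar u z * z ^ Suc k" for z
  have u': "u differentiable (at z)" if "z \<in> ball 0 1" for z
    using diff that by (simp add: differentiable_on_eq_differentiable_at)
  have f': "(f has_derivative (\<lambda>w. p z * w + q z * cnj w)) (at z)" if "z \<in> ball 0 1" for z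
    unfolding f_def p_def q_def
    by (rule derivative_eq_intros has_derivative_wirtinger[OF u'[OF that]] refl)+
      (auto simp: algebra_simps)
  have contu: "continuous_on (ball 0 1) u"
    using diff by (rule differentiable_imp_continuous_on)
  have contp: "continuous_on (ball 0 1) p" and contq: "continuous_on (ball 0 1) q"
    and contf: "continuous_on (ball 0 1) f"
    unfolding p_def q_def f_def by (intro continuous_intros cont contu)+
  let ?U = "{0<..<1::real}"
  let ?z = "\<lambda>r t. of_real r * cis t"
  have ball: "?z s t \<in> ball 0 1" if "s \<in> ?U" for s t
    using that by (simp add: norm_mult)
  \<comment> \<open>By the chain rule, \<open>fr\<close> and \<open>ft\<close> are the radial and
    angular derivatives of \<open>f\<close> in polar coordinates.\<close>
  define fr where "fr s t = p (?z s t) * cis t + q (?z s t) * cnj (cis t)" for s t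
  define ft where "ft s t = p (?z s t) * (\<i> * ?z s t) + q (?z s t) * cnj (\<i> * ?z s t)" for s t
  have dr: "((\<lambda>s. f (?z s t)) has_vector_derivative fr s t) (at s within ?U)" if "s \<in> ?U" for s t
  proof -
    have "((\<lambda>s. ?z s t) has_derivative (\<lambda>h. h *\<^sub>R cis t)) (at s within ?U)"
      by (auto intro!: derivative_eq_intros simp: scaleR_conv_of_real)
    from has_derivative_compose[OF this f'[OF ball[OF that]]] show ?thesis
      by (simp add: has_vector_derivative_def fr_def scaleR_conv_of_real algebra_simps)
  qed
  have dt: "((\<lambda>t. f (?z s t)) has_vector_derivative ft s t) (at t within T)" if "s \<in> ?U" for s t T
  proof -
    have "((\<lambda>t. ?z s t) has_derivative (\<lambda>h. h *\<^sub>R (\<i> * ?z s t))) (at t within T)"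
      by (auto intro!: derivative_eq_intros simp: scaleR_conv_of_real)
    from has_derivative_compose[OF this f'[OF ball[OF that]]] show ?thesis
      by (simp add: has_vector_derivative_def ft_def scaleR_conv_of_real algebra_simps)
  qed
  \<comment> \<open>The polar form \<open>r \<partial>\<^sub>r + i \<partial>\<^sub>t = 2 cnj z wirtinger_bar\<close>; the angular part integrates to zero.\<close>
  have polar: "fr s t = 2 * of_real s * (wirtinger_bar u (?z s t) * ?z s t ^ k) - \<i> / of_real s * ft s t"
    if "s \<in> ?U" for s t
  proof -
    have "cnj (cis t) * cis t = 1"
      by (simp add: cis_cnj cis_mult)
    then have "of_real s * (wirtinger_bar u (?z s t) * ?z s t ^ k) = q (?z s t) * cnj (cis t)"
      by (simp add: q_def algebra_simps)
    then show ?thesis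
      using that by (simp add: fr_def ft_def field_simps)
  qed
  have rU: "r \<in> ?U" using r by simp
  have "((\<lambda>s. integral (cbox 0 (2*pi)) (\<lambda>t. f (?z s t))) has_vector_derivative
      integral (cbox 0 (2*pi)) (fr r)) (at r within ?U)"
  proof (rule leibniz_rule_vector_derivative)
    show "((\<lambda>s. f (?z s t)) has_vector_derivative fr s t) (at s within ?U)" if "s \<in> ?U" for s t
      using that by (rule dr)
    show "(\<lambda>t. f (?z s t)) integrable_on cbox 0 (2*pi)" if "s \<in> ?U" for s
      by (intro integrable_continuous continuous_on_compose2[OF contf] continuous_intros)
        (use ball[OF that] in auto)
    have "continuous_on (?U \<times> cbox 0 (2*pi)) (\<lambda>x. ?z (fst x) (snd x))"
      by (intro continuous_intros)
    moreover have "(\<lambda>x. ?z (fst x) (snd x)) ` (?U \<times> cbox 0 (2*pi)) \<subseteq> ball 0 1"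
      using ball by auto
    ultimately show "continuous_on (?U \<times> cbox 0 (2*pi)) (\<lambda>(s, t). fr s t)"
      unfolding fr_def case_prod_beta
      by (intro continuous_intros continuous_on_compose2[OF contp] continuous_on_compose2[OF contq])
  qed (use rU in auto)
  then have 1: "((\<lambda>s. integral {0..2*pi} (\<lambda>t. f (?z s t))) has_vector_derivative
      integral {0..2*pi} (fr r)) (at r)"
    using r by (simp add: at_within_open[of r ?U])
  have "(ft r has_integral f (?z r (2*pi)) - f (?z r 0)) {0..2*pi}"
    by (rule fundamental_theorem_of_calculus) (use dt[OF rU] in auto)
  then have ft: "(ft r has_integral 0) {0..2*pi}"
    by simp
  have int: "(\<lambda>t. wirtinger_bar u (?z r t) * ?z r t ^ k) integrable_on {0..2*pi}"
    by (intro integrable_continuous_real continuous_intros continuous_on_compose2[OF cont(2)])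
      (use ball[OF rU] in auto)
  have "((\<lambda>t. 2 * of_real r * (wirtinger_bar u (?z r t) * ?z r t ^ k) - \<i> / of_real r * ft r t)
      has_integral 2 * of_real r * integral {0..2*pi} (\<lambda>t. wirtinger_bar u (?z r t) * ?z r t ^ k)
        - \<i> / of_real r * 0) {0..2*pi}"
    by (intro has_integral_diff has_integral_mult_right ft integrable_integral[OF int])
  then have "integral {0..2*pi} (fr r) =
      2 * of_real r * integral {0..2*pi} (\<lambda>t. wirtinger_bar u (?z r t) * ?z r t ^ k)"
    unfolding polar[OF rU, symmetric] by (simp add: integral_unique)
  with 1 show ?thesis
    by (simp add: f_def)
qed

text \<open>Cauchy's formula for the \<open>k\<close>-th derivative on a circle: in dz = i z dt the
  factor z cancels one of the \<open>Suc k\<close> powers, and the factor i cancels against the one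
  in the constant.\<close>

lemma integral_circle_holomorphic_div_power:
  fixes G :: "complex \<Rightarrow> complex"
  assumes hol: "G holomorphic_on ball 0 1" and r: "0 < r" "r < 1"
  shows "((\<lambda>t. G (of_real r * cis t) / (of_real r * cis t) ^ k)
      has_integral of_real (2 * pi) * (deriv ^^ k) G 0 / fact k) {0..2*pi}"
proof -
  have "cball 0 r \<subseteq> ball (0::complex) 1" "ball 0 r \<subseteq> ball (0::complex) 1"
    using r by auto
  then have "((\<lambda>w. G w / (w - 0) ^ Suc k) has_contour_integral
      2 * pi * \<i> / fact k * (deriv ^^ k) G 0) (circlepath 0 r)"
    using hol r by (intro Cauchy_has_contour_integral_higher_derivative_circlepath)
      (auto intro: holomorphic_on_imp_continuous_on holomorphic_on_subset[OF hol])
  then have "((\<lambda>t. G (0 + of_real r * cis t) / (0 + of_real r * cis t - 0) ^ Suc k * r * \<i> * cis t)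
      has_integral 2 * pi * \<i> / fact k * (deriv ^^ k) G 0) {0..2*pi}"
    unfolding circlepath_def by (subst (asm) has_contour_integral_part_circlepath_iff) auto
  from has_integral_mult_right[OF this, of "- \<i>"] show ?thesis
    using r by (simp add: field_simps)
qed

text \<open>After division by a nonzero \<open>c\<close> the derivative is real and, near 1, at
  least a multiple of \<open>1 / (1 - r\<^sup>2)\<close>. Its primitive then diverges at least
  logarithmically, against the finite limit; \<open>\<alpha> = -1\<close> is the borderline
  case.\<close>

lemma power_weight_primitive_unbounded:
  fixes A :: "real \<Rightarrow> complex"
  assumes \<alpha>: "\<alpha> \<le> -1"
    and A: "\<And>r. 0 < r \<Longrightarrow> r < 1 \<Longrightarrow>
      (A has_vector_derivative c * of_real ((1 - r\<^sup>2) powr \<alpha> * r ^ (2 * k + 1))) (at r)"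
    and lim: "(A \<longlongrightarrow> L) (at_left 1)"
  shows "c = 0"
proof (rule ccontr)
  assume c: "c \<noteq> 0"
  define B where "B r = Re (A r / c)" for r
  \<comment> \<open>A positive lower bound of \<open>r ^ (2 * k + 1)\<close> for \<open>r\<close> in
    [1/2, 1).\<close>
  define d :: real where "d = (1/2) ^ (2 * k + 1)"
  have d: "d > 0" by (simp add: d_def)
  have B': "(B has_real_derivative (1 - r\<^sup>2) powr \<alpha> * r ^ (2 * k + 1)) (at r)" if "0 < r" "r < 1" for r
  proof -
    have "((\<lambda>r. A r / c) has_vector_derivative of_real ((1 - r\<^sup>2) powr \<alpha> * r ^ (2 * k + 1))) (at r)"
      using has_vector_derivative_divide[OF A[OF that], of c] c by simp
    from bounded_linear.has_vector_derivative[OF bounded_linear_Re this] show ?thesis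
      by (simp add: B_def[abs_def] has_real_derivative_iff_has_vector_derivative del: of_real_mult)
  qed
  \<comment> \<open>\<open>B\<close> grows at least as fast as a positive multiple of \<open>- ln (1 - r\<^sup>2)\<close>.\<close>
  define H where "H r = B r + d / 2 * ln (1 - r\<^sup>2)" for r
  have mono: "H (1/2) \<le> H r" if "1/2 \<le> r" "r < 1" for r
  proof (rule DERIV_nonneg_imp_nondecreasing[OF that(1)])
    fix x assume x: "1/2 \<le> x" "x \<le> r"
    then have x1: "0 < x" "x < 1" using that by auto
    then have w: "0 < 1 - x\<^sup>2" "1 - x\<^sup>2 \<le> 1"
      by (auto simp: power_less_one_iff abs_square_less_1)
    have "(H has_real_derivative (1 - x\<^sup>2) powr \<alpha> * x ^ (2 * k + 1) - d * x / (1 - x\<^sup>2)) (at x)"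
      unfolding H_def
      by (rule derivative_eq_intros B' x1 w refl)+ (use w in \<open>simp_all add: field_simps\<close>)
    moreover have "d * x / (1 - x\<^sup>2) \<le> (1 - x\<^sup>2) powr \<alpha> * x ^ (2 * k + 1)"
    proof -
      have "(1 - x\<^sup>2) powr (-1) \<le> (1 - x\<^sup>2) powr \<alpha>"
        using w \<alpha> by (intro powr_mono') auto
      then have "1 / (1 - x\<^sup>2) \<le> (1 - x\<^sup>2) powr \<alpha>"
        using w by (simp add: powr_minus_divide)
      moreover have "d * x \<le> x ^ (2 * k + 1)"
      proof -
        have "d * x \<le> d * 1"
          using x1 d by (intro mult_left_mono) auto
        also have "d * 1 \<le> x ^ (2 * k + 1)"
          unfolding d_def mult_1_right using x by (intro power_mono) auto
        finally show ?thesis .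
      qed
      ultimately show ?thesis
        using mult_mono[of "1 / (1 - x\<^sup>2)" "(1 - x\<^sup>2) powr \<alpha>" "d * x" "x ^ (2 * k + 1)"] d x1
        by simp
    qed
    ultimately show "\<exists>y. DERIV H x :> y \<and> 0 \<le> y"
      by force
  qed
  \<comment> \<open>With \<open>B\<close> convergent, the logarithm drives \<open>H\<close> to minus
    infinity, below its value at 1/2, which contradicts \<open>mono\<close>.\<close>
  have "filterlim (\<lambda>r::real. - ln (1 - r\<^sup>2)) at_top (at_left 1)"
    by real_asymp
  moreover have "((\<lambda>r. - B r) \<longlongrightarrow> - Re (L / c)) (at_left 1)"
    unfolding B_def using c by (intro tendsto_intros lim)
  ultimately have "filterlim (\<lambda>r. - B r + d / 2 * (- ln (1 - r\<^sup>2))) at_top (at_left 1)"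
    using d by (intro filterlim_tendsto_add_at_top filterlim_tendsto_pos_mult_at_top[OF tendsto_const]) auto
  then have "eventually (\<lambda>r. - H (1/2) < - B r + d / 2 * (- ln (1 - r\<^sup>2))) (at_left 1)"
    by (simp only: filterlim_at_top_dense)
  then have "eventually (\<lambda>r. H r < H (1/2)) (at_left 1)"
    by eventually_elim (simp add: H_def)
  moreover have "eventually (\<lambda>r::real. r \<in> {1/2<..<1}) (at_left 1)"
    by (rule eventually_at_leftI[of "1/2"]) auto
  ultimately have "eventually (\<lambda>r::real. False) (at_left 1)"
    by eventually_elim (use mono in force)
  then show False by simp
qed

text \<open>Links the moments over the circle of radius \<open>r\<close> to the pairing on the unit
  circle; continuity identifies the Lebesgue integral with the gauge integral.\<close>

lemma distribution_of_dilation_power: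
  assumes "continuous_on (ball 0 1) u" "0 < r" "r < 1"
  shows "integral {0..2*pi} (\<lambda>t. u (of_real r * cis t) * (of_real r * cis t) ^ n) =
    of_real (2 * pi * r ^ n) * distribution_of (dilation u r) (\<lambda>z. z ^ n)"
proof -
  have "continuous_on {0..2*pi} (\<lambda>t. dilation u r (cis t) * cis t ^ n)"
    unfolding dilation_def
    by (intro continuous_intros continuous_on_compose2[OF assms(1)])
      (use assms in \<open>auto simp: norm_mult\<close>)
  then have "distribution_of (dilation u r) (\<lambda>z. z ^ n) =
      integral {0..2*pi} (\<lambda>t. dilation u r (cis t) * cis t ^ n) / (2 * pi)"
    unfolding distribution_of_def
    by (subst set_borel_integral_eq_integral) (auto intro: borel_integrable_atLeastAtMost')
  moreover have "integral {0..2*pi} (\<lambda>t. u (of_real r * cis t) * (of_real r * cis t) ^ n) =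
      of_real r ^ n * integral {0..2*pi} (\<lambda>t. dilation u r (cis t) * cis t ^ n)"
    by (subst integral_mult_right[symmetric]) (simp add: dilation_def power_mult_distrib mult_ac)
  ultimately show ?thesis by simp
qed

theorem theorem3p5:
  fixes \<alpha> :: real and u :: "complex \<Rightarrow> complex"
  assumes "\<alpha> \<le> -1"
    and "alpha_harmonic \<alpha> u"
    and "\<exists>f. circle_distribution f \<and>
           tendsto_circle_distribution (\<lambda>r. distribution_of (dilation u r)) f (at_left 1)"
  shows "u analytic_on ball 0 1"
proof -
  have Ck: "Ck_on 2 u (ball 0 1)"
    using assms(2) by (simp add: alpha_harmonic_def)
  then have diff: "u differentiable_on ball 0 1"
    and dx: "partial_x u differentiable_on ball 0 1" and dy: "partial_y u differentiable_on ball 0 1"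
    by (auto simp: numeral_2_eq_2)
  have db: "wirtinger_bar u differentiable_on ball 0 1"
    unfolding wirtinger_bar_def divide_inverse using dx dy
    by (auto simp: differentiable_on_def intro!: differentiable_add differentiable_mult)
  have contw: "continuous_on (ball 0 1) (wirtinger u)" "continuous_on (ball 0 1) (wirtinger_bar u)"
    unfolding wirtinger_def wirtinger_bar_def
    by (intro continuous_intros differentiable_imp_continuous_on dx dy; simp)+
  define h where "h w = of_real ((1 - (cmod w)\<^sup>2) powr (- \<alpha>)) * wirtinger_bar u w" for w
  have wpos: "0 < 1 - (cmod z)\<^sup>2" if "z \<in> ball 0 1" for z
    using that by (simp add: abs_square_less_1)
  have "wirtinger h z = 0" if "z \<in> ball 0 1" for z
    using assms(2) that unfolding alpha_harmonic_def h_def by blast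
  have dh: "h differentiable (at z)" if "z \<in> ball 0 1" for z
  proof -
    have "wirtinger_bar u differentiable (at z)"
      using db that by (simp add: differentiable_on_eq_differentiable_at)
    \<comment> \<open>The inner product replaces the squared norm because the norm itself is not
      differentiable at 0.\<close>
    have "\<exists>D. ((\<lambda>w. (1 - w \<bullet> w) powr (- \<alpha>)) has_derivative D) (at z)"
      using wpos[OF that] by (intro exI) (rule derivative_eq_intros refl | simp add: power2_norm_eq_inner)+
    then have "(\<lambda>w. complex_of_real ((1 - (cmod w)\<^sup>2) powr (- \<alpha>))) differentiable (at z)"
      unfolding differentiable_def power2_norm_eq_inner using has_derivative_of_real by fast
    then show ?thesis
      unfolding h_def using \<open>wirtinger_bar u differentiable (at z)\<close> by (rule differentiable_mult)
  qed
  \<comment> \<open>Since \<open>wirtinger h\<close> vanishes, the derivative of \<open>h\<close> is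
    conjugate-linear; conjugation makes it complex-linear.\<close>
  define G where "G z = cnj (h z)" for z
  have "(G has_field_derivative cnj (wirtinger_bar h z)) (at z)" if "z \<in> ball 0 1" for z
    using has_derivative_cnj[OF has_derivative_wirtinger[OF dh[OF that]]]
      \<open>z \<in> ball 0 1 \<Longrightarrow> wirtinger h z = 0\<close> that
    by (simp add: G_def[abs_def] has_field_derivative_def)
  then have hol: "G holomorphic_on ball 0 1"
    by (subst holomorphic_on_open) blast+
  have wbar: "wirtinger_bar u z = of_real ((1 - (cmod z)\<^sup>2) powr \<alpha>) * cnj (G z)" if "z \<in> ball 0 1" for z
    using wpos[OF that] by (simp add: G_def h_def powr_minus flip: of_real_mult mult.assoc)
  obtain f where f: "tendsto_circle_distribution (\<lambda>r. distribution_of (dilation u r)) f (at_left 1)"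
    using assms(3) by blast
  have coeff: "(deriv ^^ k) G 0 = 0" for k
  proof -
    \<comment> \<open>\<open>c\<close> is 2 pi times the \<open>k\<close>-th Taylor coefficient of
      \<open>G\<close> at 0.\<close>
    define c where "c = of_real (2 * pi) * (deriv ^^ k) G 0 / fact k"
    define A where "A r = integral {0..2*pi} (\<lambda>t. u (of_real r * cis t) * (of_real r * cis t) ^ Suc k)"
      for r :: real
    have "(A has_vector_derivative (2 * cnj c) * of_real ((1 - r\<^sup>2) powr \<alpha> * r ^ (2 * k + 1))) (at r)"
      if r: "0 < r" "r < 1" for r
    proof -
      have "wirtinger_bar u (of_real r * cis t) * (of_real r * cis t) ^ k =
          of_real ((1 - r\<^sup>2) powr \<alpha> * r ^ (2 * k)) *
            cnj (G (of_real r * cis t) / (of_real r * cis t) ^ k)" for t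
      proof -
        \<comment> \<open>On the circle \<open>z ^ k\<close> equals
          \<open>r ^ (2 * k) / cnj z ^ k\<close>, which turns the moment of \<open>cnj G\<close>
          into the conjugate of a Cauchy integral.\<close>
        have "of_real r * cis t * cnj (of_real r * cis t) = (of_real r)\<^sup>2"
          using complex_norm_square[of "of_real r * cis t"] by (simp add: norm_mult)
        then have "(of_real r * cis t) ^ k * cnj (of_real r * cis t) ^ k = of_real r ^ (2 * k)"
          by (metis power_mult power_mult_distrib)
        then show ?thesis
          using r by (subst wbar) (auto simp: norm_mult field_simps)
      qed
      moreover have "((\<lambda>t. of_real ((1 - r\<^sup>2) powr \<alpha> * r ^ (2 * k)) *
            cnj (G (of_real r * cis t) / (of_real r * cis t) ^ k)) has_integral
          of_real ((1 - r\<^sup>2) powr \<alpha> * r ^ (2 * k)) * cnj c) {0..2*pi}"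
        unfolding c_def
        by (intro has_integral_mult_right has_integral_cnj[THEN iffD2, unfolded o_def]
            integral_circle_holomorphic_div_power[OF hol r])
      ultimately have "integral {0..2*pi} (\<lambda>t. wirtinger_bar u (of_real r * cis t) * (of_real r * cis t) ^ k)
          = of_real ((1 - r\<^sup>2) powr \<alpha> * r ^ (2 * k)) * cnj c"
        by (simp add: integral_unique)
      with has_vector_derivative_circle_moment[OF diff contw r, of k] show ?thesis
        by (simp add: A_def[abs_def] mult_ac)
    qed
    \<comment> \<open>Near 1, \<open>A r\<close> is the pairing with \<open>z ^ Suc k\<close> times
      \<open>2 * pi * r ^ Suc k\<close>; both factors converge.\<close>
    moreover have "(A \<longlongrightarrow> of_real (2 * pi * 1 ^ Suc k) * f (\<lambda>z. z ^ Suc k)) (at_left 1)"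
    proof (rule Lim_transform_eventually)
      show "((\<lambda>r. of_real (2 * pi * r ^ Suc k) * distribution_of (dilation u r) (\<lambda>z. z ^ Suc k))
          \<longlongrightarrow> of_real (2 * pi * 1 ^ Suc k) * f (\<lambda>z. z ^ Suc k)) (at_left 1)"
        using f power_in_smooth_circle[of "Suc k"] unfolding tendsto_circle_distribution_def
        by (intro tendsto_intros) auto
      show "\<forall>\<^sub>F r in at_left 1. of_real (2 * pi * r ^ Suc k) *
          distribution_of (dilation u r) (\<lambda>z. z ^ Suc k) = A r"
        unfolding A_def
        by (intro eventually_at_leftI[of 0] distribution_of_dilation_power[symmetric])
          (auto intro: differentiable_imp_continuous_on diff)
    qed
    ultimately have "2 * cnj c = 0"
      by (rule power_weight_primitive_unbounded[OF assms(1)])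
    then show ?thesis by (simp add: c_def)
  qed
  have "wirtinger_bar u z = 0" if "z \<in> ball 0 1" for z
  proof -
    \<comment> \<open>All Taylor coefficients at the centre vanish, so the identity theorem applies
      on the connected disc.\<close>
    have "G z = 0"
      by (rule holomorphic_fun_eq_0_on_connected[OF hol _ _ coeff]) (use that in auto)
    then show ?thesis using wbar[OF that] by simp
  qed
  then have "(u has_field_derivative wirtinger u z) (at z)" if "z \<in> ball 0 1" for z
    using has_derivative_wirtinger[of u z] diff that
    by (simp add: has_field_derivative_def differentiable_on_eq_differentiable_at)
  then have "u holomorphic_on ball 0 1"
    by (subst holomorphic_on_open) blast+
  then show ?thesis
    by (simp add: analytic_on_open)
qed

end
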